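(* Every classical (not necessarily terminating) $\mathrm{EC}(\mathcal{D})$ $T=(\emptyset,V,E)$ (with the empty word as root) has a branch $B$ such that for every vertex $u\in B$ the point $(0,0)$ is not a letter of $u$. Thus no general classical $\mathrm{EC}(\mathcal{D})$ constructs $$\mathcal{K}=\{(0,0)\}$$ (the origin, as a one-letter word) from nothing, i.e. from the empty word.
   Context: For a set (alphabet) $A$, $A^*$ is the set of finite words over $A$, including the empty word $\emptyset$. A rooted tree $T=(r,V,E)$ consists of a vertex set $V$, a root $r\in V$ and edges $E\subset V\times V$ such that for every $u\in V$ there is a unique walk from $r$ to $u$; if $(u,v)\in E$ then $v$ is a child of $u$; a leaf is a vertex with no child; a branch is a maximal (finite or infinite) walk; it starts at $r$ and either ends in a leaf or is infinite. $\mathcal{P}=\mathbb{R}^2$ is the set of points, $\mathcal{L}$ the set of lines in $\mathbb{R}^2$, $\mathcal{C}$ the set of circles of positive radius in $\mathbb{R}^2$; elements of $\mathcal{L}\cup\mathcal{C}$ are called curves. For points $a\ne b$, $l(a,b)$ is the line through $a,b$. For points $a$ and $b\neq c$, $k(a,b,c)$ is the circle with center $a$ and radius $|bc|$; moreover $k(a,b,b)=a\in\mathcal{P}$. $\mathcal{D}$ is the set of all open discs in $\mathbb{R}^2$ with positive radii. Let $\mathcal{S}$ be a set of nonempty subsets of $\mathbb{R}^2$ with $(\mathcal{P}\cup\mathcal{L}\cup\mathcal{C})\cap\mathcal{S}=\emptyset$. An $\mathrm{EC}(\mathcal{S})$ (Euclidean construction with $\mathcal{S}$-arbitrary points) is a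 rooted tree $T=(r,V,E)$ with $V\subset(\mathcal{P}\cup\mathcal{L}\cup\mathcal{C}\cup\mathcal{S})^*$ and $r\in(\mathcal{P}\cup\mathcal{L}\cup\mathcal{C})^*$, in which the children of each vertex $u=a_1a_2\dots a_m$, $m\ge0$, are determined by exactly one of the following rules; in rules 1–5, $u$ is deterministic, i.e. $m=0$ or $a_m\notin\mathcal{S}$. 1. $u$ is a leaf. 2. $u$ has exactly one child $a_1\dots a_ma_{m+1}$, where $a_{m+1}=l(a_i,a_j)$ for some $1\le i<j\le m$ with $a_i,a_j\in\mathcal{P}$, $a_i\ne a_j$. 3. $u$ has exactly one child $a_1\dots a_ma_{m+1}$, where $a_{m+1}=k(a_i,a_j,a_k)$ for some $1\le i,j,k\le m$ with $a_i,a_j,a_k\in\mathcal{P}$. 4. $u$ has exactly one child $a_1\dots a_ma_{m+1}$, where $a_{m+1}\in\mathcal{P}$ is an intersection point of two curves $a_i\ne a_j$, $1\le i<j\le m$. 5. $u$ has exactly one child $a_1\dots a_ma_{m+1}$, where $a_{m+1}\in\mathcal{S}$. 6. $m\ge1$, $a_m\in\mathcal{S}$ ($u$ is non-deterministic) and the children of $u$ are exactly the words $a_1\dots a_ma_{m+1}$, one for each point $a_{m+1}\in a_m$. A general construction is one in which all these rules are allowed (both compass and straightedge). $T$ is classical if $\mathcal{S}=\mathcal{D}$. $T$ is terminating if all its branches are finite. For $\mathcal{K}\subset(\mathcal{P}\cup\mathcal{L}\cup\mathcal{C})^*$, an $\mathrm{EC}(\mathcal{S})$ of a certain type constructs $\mathcal{K}$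 from $r$ if there is a terminating $\mathrm{EC}(\mathcal{S})$ $T=(r,V,E)$ of that type with root $r$ such that every leaf $a_1\dots a_m$ of $T$ has a final segment $a_ja_{j+1}\dots a_m\in\mathcal{K}$. *)

theory Defs
  imports "HOL-Analysis.Analysis" "HOL-Library.Sublist"
begin

section \<open>Rooted trees\<close>

text \<open>Walks are finite nonempty or infinite sequences of vertices; a one-vertex walk is allowed.\<close>

datatype 'v walk = Finite "'v list" | Infinite "nat \<Rightarrow> 'v"

fun walk_verts :: "'v walk \<Rightarrow> 'v set" where
  "walk_verts (Finite xs) = set xs"
| "walk_verts (Infinite f) = range f"

fun is_walk :: "'v set \<Rightarrow> ('v \<times> 'v) set \<Rightarrow> 'v walk \<Rightarrow> bool" where
  "is_walk V E (Finite xs) \<longleftrightarrow>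
     xs \<noteq> [] \<and> set xs \<subseteq> V \<and> successively (\<lambda>u v. (u, v) \<in> E) xs"
| "is_walk V E (Infinite f) \<longleftrightarrow>
     range f \<subseteq> V \<and> (\<forall>n. (f n, f (Suc n)) \<in> E)"

definition rooted_tree :: "'v \<Rightarrow> 'v set \<Rightarrow> ('v \<times> 'v) set \<Rightarrow> bool" where
  "rooted_tree r V E \<longleftrightarrow> r \<in> V \<and> E \<subseteq> V \<times> V \<and>
     (\<forall>u\<in>V. \<exists>!xs. is_walk V E (Finite xs) \<and> hd xs = r \<and> last xs = u)"

definition children :: "('v \<times> 'v) set \<Rightarrow> 'v \<Rightarrow> 'v set" where
  "children E u = {v. (u, v) \<in> E}"

definition is_leaf :: "'v set \<Rightarrow> ('v \<times> 'v) set \<Rightarrow> 'v \<Rightarrow> bool" where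
  "is_leaf V E u \<longleftrightarrow> u \<in> V \<and> children E u = {}"

text \<open>\<open>segment_of w w'\<close>: the walk \<open>w\<close> is a block of consecutive vertices of \<open>w'\<close>, so that
  maximality below excludes extensions at either end.\<close>

fun segment_of :: "'v walk \<Rightarrow> 'v walk \<Rightarrow> bool" where
  "segment_of (Finite xs) (Finite ys) \<longleftrightarrow> sublist xs ys"
| "segment_of (Finite xs) (Infinite g) \<longleftrightarrow> (\<exists>n. xs = map g [n..<n + length xs])"
| "segment_of (Infinite f) (Infinite g) \<longleftrightarrow> (\<exists>n. \<forall>k. f k = g (n + k))"
| "segment_of (Infinite f) (Finite ys) \<longleftrightarrow> False"

definition branch :: "'v set \<Rightarrow> ('v \<times> 'v) set \<Rightarrow> 'v walk \<Rightarrow> bool" where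
  "branch V E w \<longleftrightarrow> is_walk V E w \<and> (\<forall>w'. is_walk V E w' \<and> segment_of w w' \<longrightarrow> w' = w)"

definition terminating :: "'v set \<Rightarrow> ('v \<times> 'v) set \<Rightarrow> bool" where
  "terminating V E \<longleftrightarrow> (\<forall>w. branch V E w \<longrightarrow> (\<exists>xs. w = Finite xs))"

lemma no_edge_into_root:
  assumes "rooted_tree r V E"
  shows "(p, r) \<notin> E"
proof
  assume e: "(p, r) \<in> E"
  then have "p \<in> V" and r: "r \<in> V" using assms by (auto simp: rooted_tree_def)
  then obtain xs where xs: "is_walk V E (Finite xs)" "hd xs = r" "last xs = p"
    using assms unfolding rooted_tree_def by blast
  have "is_walk V E (Finite (xs @ [r]))" "hd (xs @ [r]) = r" "last (xs @ [r]) = r"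
    using xs e r by (auto simp: successively_append_iff)
  moreover have "is_walk V E (Finite [r])" "hd [r] = r" "last [r] = r" using r by auto
  ultimately have "xs @ [r] = [r]" using assms r unfolding rooted_tree_def by metis
  with xs show False by simp
qed

lemma edge_into_nonroot:
  assumes "rooted_tree r V E" "v \<in> V" "v \<noteq> r"
  obtains p where "p \<in> V" "(p, v) \<in> E"
proof -
  obtain xs where xs: "is_walk V E (Finite xs)" "hd xs = r" "last xs = v"
    using assms unfolding rooted_tree_def by blast
  then obtain ys where ys: "xs = ys @ [v]"
    by (metis append_butlast_last_id is_walk.simps(1))
  with xs assms(3) have "ys \<noteq> []" by auto
  with xs ys have "last ys \<in> V" "(last ys, v) \<in> E"
    by (auto simp: successively_append_iff)
  then show thesis by (rule that)
qed

text \<open>In a rooted tree, branches are the walks that start at the root and either end in a leaf or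
  are infinite.\<close>

lemma branch_Finite_iff:
  assumes T: "rooted_tree r V E"
  shows "branch V E (Finite xs) \<longleftrightarrow>
    is_walk V E (Finite xs) \<and> hd xs = r \<and> is_leaf V E (last xs)"
proof (intro iffI conjI)
  assume b: "branch V E (Finite xs)"
  then show w: "is_walk V E (Finite xs)" by (simp add: branch_def)
  have max: "ys = xs" if "is_walk V E (Finite ys)" "sublist xs ys" for ys
    using b that unfolding branch_def by (metis segment_of.simps(1) walk.inject(1))
  show "hd xs = r"
  proof (rule ccontr)
    assume "hd xs \<noteq> r"
    moreover have "hd xs \<in> V" using w by auto
    ultimately obtain p where "p \<in> V" "(p, hd xs) \<in> E" using edge_into_nonroot[OF T] by blast
    with w have "is_walk V E (Finite (p # xs))" by (cases xs) auto
    then have "p # xs = xs" by (rule max) (simp add: sublist_Cons_right)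
    then show False by simp
  qed
  show "is_leaf V E (last xs)"
  proof (rule ccontr)
    assume "\<not> is_leaf V E (last xs)"
    moreover have "last xs \<in> V" using w by auto
    ultimately obtain v where e: "(last xs, v) \<in> E" by (auto simp: is_leaf_def children_def)
    then have "v \<in> V" using T by (auto simp: rooted_tree_def)
    with e w have "is_walk V E (Finite (xs @ [v]))" by (auto simp: successively_append_iff)
    then have "xs @ [v] = xs" by (rule max) simp
    then show False by simp
  qed
next
  assume a: "is_walk V E (Finite xs) \<and> hd xs = r \<and> is_leaf V E (last xs)"
  then have ne: "xs \<noteq> []" and noout: "(last xs, v) \<notin> E" for v
    by (auto simp: is_leaf_def children_def)
  show "branch V E (Finite xs)"
    unfolding branch_def
  proof (intro conjI allI impI)
    fix w' assume w': "is_walk V E w' \<and> segment_of (Finite xs) w'"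
    show "w' = Finite xs"
    proof (cases w')
      case (Finite ys)
      then obtain ps ss where ys: "ys = ps @ xs @ ss" using w' by (auto simp: sublist_def)
      have s: "successively (\<lambda>u v. (u, v) \<in> E) (ps @ xs @ ss)" using w' Finite ys by simp
      have "ps = []"
        using s ne a no_edge_into_root[OF T] by (auto simp: successively_append_iff)
      moreover have "ss = []"
        using s ne noout by (auto simp: successively_append_iff)
      ultimately show ?thesis using ys Finite by simp
    next
      case (Infinite g)
      then obtain n where xs: "xs = map g [n..<n + length xs]" using w' by auto
      have "last xs = xs ! (length xs - 1)" using ne by (rule last_conv_nth)
      also have "\<dots> = g (n + (length xs - 1))"
        using ne by (subst xs) simp
      finally have "(last xs, g (Suc (n + (length xs - 1)))) \<in> E" using w' Infinite by simp
      with noout show ?thesis by blast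
    qed
  qed (use a in simp)
qed

lemma branch_Infinite_iff:
  assumes T: "rooted_tree r V E"
  shows "branch V E (Infinite f) \<longleftrightarrow> is_walk V E (Infinite f) \<and> f 0 = r"
proof (intro iffI conjI)
  assume b: "branch V E (Infinite f)"
  then show w: "is_walk V E (Infinite f)" by (simp add: branch_def)
  show "f 0 = r"
  proof (rule ccontr)
    assume "f 0 \<noteq> r"
    moreover have "f 0 \<in> V" using w by auto
    ultimately obtain p where p: "p \<in> V" "(p, f 0) \<in> E" using edge_into_nonroot[OF T] by blast
    define g where "g = case_nat p f"
    have "is_walk V E (Infinite g)"
      using p w by (force simp: g_def split: nat.splits)
    moreover have "segment_of (Infinite f) (Infinite g)"
      by (auto simp: g_def intro: exI[of _ 1])
    ultimately have "g = f" using b unfolding branch_def by blast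
    then have fp: "f 0 = p" by (metis g_def old.nat.simps(4))
    with p have "(f 0, f 0) \<in> E" by simp
    moreover from fp obtain xs where xs: "is_walk V E (Finite xs)" "hd xs = r" "last xs = f 0"
      using T p unfolding rooted_tree_def by blast
    ultimately have "is_walk V E (Finite (xs @ [f 0]))" "hd (xs @ [f 0]) = r"
      "last (xs @ [f 0]) = f 0"
      using \<open>f 0 \<in> V\<close> by (auto simp: successively_append_iff)
    with xs have "xs @ [f 0] = xs"
      using T \<open>f 0 \<in> V\<close> unfolding rooted_tree_def by metis
    then show False by simp
  qed
next
  assume a: "is_walk V E (Infinite f) \<and> f 0 = r"
  show "branch V E (Infinite f)"
    unfolding branch_def
  proof (intro conjI allI impI)
    fix w' assume w': "is_walk V E w' \<and> segment_of (Infinite f) w'"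
    then obtain g n where g: "w' = Infinite g" "\<And>k. f k = g (n + k)" by (cases w') auto
    have "n = 0"
    proof (cases n)
      case (Suc m)
      have "(g m, g (Suc m)) \<in> E" using w' g by simp
      moreover have "g (Suc m) = r" using g(2)[of 0] a Suc by simp
      ultimately show ?thesis using no_edge_into_root[OF T] by auto
    qed
    with g show "w' = Infinite f" by auto
  qed (use a in simp)
qed


section \<open>Euclidean constructions\<close>

type_synonym point = "real^2"

text \<open>The alphabet: points, and subsets of the plane (lines, circles, and the members of the set
  \<open>S\<close> of regions from which arbitrary points may be chosen).\<close>

datatype letter = Pt point | Fig "point set"

type_synonym word = "letter list"

definition line_through :: "point \<Rightarrow> point \<Rightarrow> point set" where
  "line_through a b = affine hull {a, b}"

definition lines :: "point set set" where
  "lines = {line_through a b | a b. a \<noteq> b}"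

definition circles :: "point set set" where
  "circles = {sphere c \<rho> | c \<rho>. \<rho> > 0}"

definition open_discs :: "point set set" where
  "open_discs = {ball c \<rho> | c \<rho>. \<rho> > 0}"

text \<open>The circle with centre \<open>a\<close> and radius \<open>|bc|\<close>, degenerating to the point \<open>a\<close> if \<open>b = c\<close>.\<close>

definition compass :: "point \<Rightarrow> point \<Rightarrow> point \<Rightarrow> letter" where
  "compass a b c = (if b = c then Pt a else Fig (sphere a (dist b c)))"

definition basic_letters :: "letter set" where
  "basic_letters = range Pt \<union> Fig ` (lines \<union> circles)"

text \<open>Points and sets are different letters, so only lines and circles need to be kept apart from
  \<open>S\<close>.\<close>

definition admissible :: "point set set \<Rightarrow> bool" where
  "admissible S \<longleftrightarrow> {} \<notin> S \<and> (lines \<union> circles) \<inter> S = {}"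

definition deterministic :: "point set set \<Rightarrow> word \<Rightarrow> bool" where
  "deterministic S u \<longleftrightarrow> u = [] \<or> last u \<notin> Fig ` S"

text \<open>\<open>ec_rule S u C\<close>: one of the construction rules allows \<open>C\<close> to be the set of children of \<open>u\<close>.
  Rules may overlap (for instance \<open>circle\<close> with \<open>b = c\<close> can yield the same point as
  \<open>intersection\<close>).\<close>

inductive ec_rule :: "point set set \<Rightarrow> word \<Rightarrow> word set \<Rightarrow> bool"
  for S :: "point set set" and u :: word where
  leaf: "deterministic S u \<Longrightarrow> ec_rule S u {}"
| line: "\<lbrakk>deterministic S u; i < j; j < length u; u ! i = Pt a; u ! j = Pt b; a \<noteq> b\<rbrakk>
    \<Longrightarrow> ec_rule S u {u @ [Fig (line_through a b)]}"
| circle: "\<lbrakk>deterministic S u; i < length u; j < length u; k < length u;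
      u ! i = Pt a; u ! j = Pt b; u ! k = Pt c\<rbrakk>
    \<Longrightarrow> ec_rule S u {u @ [compass a b c]}"
| intersection: "\<lbrakk>deterministic S u; i < j; j < length u; u ! i = Fig X; u ! j = Fig Y;
      X \<in> lines \<union> circles; Y \<in> lines \<union> circles; X \<noteq> Y; p \<in> X \<inter> Y\<rbrakk>
    \<Longrightarrow> ec_rule S u {u @ [Pt p]}"
| region: "\<lbrakk>deterministic S u; D \<in> S\<rbrakk> \<Longrightarrow> ec_rule S u {u @ [Fig D]}"
| arbitrary_point: "\<lbrakk>u \<noteq> []; last u = Fig D; D \<in> S\<rbrakk>
    \<Longrightarrow> ec_rule S u {u @ [Pt p] | p. p \<in> D}"

text \<open>General (compass and straightedge) constructions; they are classical if
  \<open>S = open_discs\<close>.\<close>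

definition EC :: "point set set \<Rightarrow> word \<Rightarrow> word set \<Rightarrow> (word \<times> word) set \<Rightarrow> bool" where
  "EC S r V E \<longleftrightarrow> admissible S \<and> rooted_tree r V E \<and>
     V \<subseteq> lists (basic_letters \<union> Fig ` S) \<and> r \<in> lists basic_letters \<and>
     (\<forall>u\<in>V. ec_rule S u (children E u))"

definition constructs :: "point set set \<Rightarrow> word set \<Rightarrow> word \<Rightarrow> bool" where
  "constructs S K r \<longleftrightarrow> (\<exists>V E. EC S r V E \<and> terminating V E \<and>
     (\<forall>u. is_leaf V E u \<longrightarrow> (\<exists>j<length u. drop j u \<in> K)))"

lemma admissible_open_discs: "admissible open_discs"
proof -
  have "False" if "D \<in> open_discs" "D \<in> lines" for D
  proof -
    from that obtain a b c \<rho> where D: "D = affine hull {a, b}" "D = ball c \<rho>" "\<rho> > 0"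
      by (auto simp: lines_def open_discs_def line_through_def)
    have "closed D" unfolding D(1) by (rule closed_affine_hull)
    moreover have "open D" "D \<noteq> {}" unfolding D(2) using D(3) by auto
    ultimately have "D = UNIV" using clopen by blast
    then show False using D(2) not_bounded_UNIV[where 'a = point] bounded_ball by metis
  qed
  moreover have "False" if "D \<in> open_discs" "D \<in> circles" for D
  proof -
    from that obtain a s c \<rho> where D: "D = sphere a s" "D = ball c \<rho>" "\<rho> > 0"
      by (auto simp: circles_def open_discs_def)
    have "closed D" unfolding D(1) by (rule closed_sphere)
    moreover have "open D" "D \<noteq> {}" unfolding D(2) using D(3) by auto
    ultimately have "D = UNIV" using clopen by blast
    then show False using D(2) not_bounded_UNIV[where 'a = point] bounded_ball by metis
  qed
  moreover have "{} \<notin> open_discs"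
    unfolding open_discs_def using centre_in_ball by blast
  ultimately show ?thesis unfolding admissible_def by blast
qed

end

theory Submission
  imports Defs
begin

text \<open>Let \<open>F\<close> be a countable subfield of the reals that is closed under square roots. Then
  \<open>F\<^sup>2\<close> is dense in the plane and closed under ruler and compass constructions, hence so is every
  translate \<open>t + F\<^sup>2\<close>. If \<open>t \<notin> F\<^sup>2\<close>, this translate misses the origin, so it suffices to pick all
  arbitrary points from it.\<close>

section \<open>The countable field of surds, closed under square roots\<close>

text \<open>Formal terms make countability automatic; subtraction and division already generate all
  four field operations.\<close>

datatype surd = One | Diff surd surd | Quot surd surd | Root surd

instance surd :: countable
  by countable_datatype

text \<open>Every term has a real value, since division by zero gives 0 and \<open>sqrt\<close> is
  an odd function. Hence closure holds without side conditions, and the values are exactly the real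
  constructible numbers.\<close>

primrec surd_val :: "surd \<Rightarrow> real" where
  "surd_val One = 1"
| "surd_val (Diff x y) = surd_val x - surd_val y"
| "surd_val (Quot x y) = surd_val x / surd_val y"
| "surd_val (Root x) = sqrt (surd_val x)"

definition surds :: "real set" where
  "surds = range surd_val"

lemma countable_surds: "countable surds"
  by (simp add: surds_def)

lemma surds_1 [simp]: "1 \<in> surds"
  unfolding surds_def by (metis rangeI surd_val.simps(1))

lemma surds_diff [simp]: "x \<in> surds \<Longrightarrow> y \<in> surds \<Longrightarrow> x - y \<in> surds"
  unfolding surds_def by (auto simp flip: surd_val.simps(2))

lemma surds_divide [simp]: "x \<in> surds \<Longrightarrow> y \<in> surds \<Longrightarrow> x / y \<in> surds"
  unfolding surds_def by (auto simp flip: surd_val.simps(3))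

lemma surds_sqrt [simp]: "x \<in> surds \<Longrightarrow> sqrt x \<in> surds"
  unfolding surds_def by (auto simp flip: surd_val.simps(4))

lemma surds_0 [simp]: "0 \<in> surds"
  using surds_diff[OF surds_1 surds_1] by simp

lemma surds_uminus_iff [simp]: "- x \<in> surds \<longleftrightarrow> x \<in> surds"
  using surds_diff[OF surds_0, of x] surds_diff[OF surds_0, of "- x"] by auto

lemma surds_abs_iff [simp]: "\<bar>x\<bar> \<in> surds \<longleftrightarrow> x \<in> surds"
  by (simp add: abs_if)

lemma surds_add [simp]: "x \<in> surds \<Longrightarrow> y \<in> surds \<Longrightarrow> x + y \<in> surds"
  using surds_diff[of x "- y"] by simp

lemma surds_mult [simp]: "x \<in> surds \<Longrightarrow> y \<in> surds \<Longrightarrow> x * y \<in> surds"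
  using surds_divide[of x "1 / y"] by simp

lemma surds_power [simp]: "x \<in> surds \<Longrightarrow> x ^ n \<in> surds"
  by (induction n) auto

lemma surds_of_nat [simp]: "of_nat n \<in> surds"
  by (induction n) auto

lemma surds_numeral [simp]: "numeral n \<in> surds"
  using surds_of_nat[of "numeral n"] by simp

lemma surds_of_int: "of_int k \<in> surds"
  by (cases k) (simp_all del: of_nat_Suc)

text \<open>Serves to make the surds dense in the reals.\<close>

lemma Rats_subset_surds: "\<rat> \<subseteq> surds"
proof
  fix x :: real assume "x \<in> \<rat>"
  then obtain a b :: int where "x = of_int a / of_int b" by (auto elim: Rats_cases')
  then show "x \<in> surds" by (simp add: surds_of_int)
qed

text \<open>Completing the square: \<open>2 * a * x + b\<close> is, up to sign, the square root of
  the discriminant.\<close>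

lemma surds_quadratic_root:
  assumes "a \<in> surds" "b \<in> surds" "c \<in> surds" "a \<noteq> 0" "a * x\<^sup>2 + b * x + c = 0"
  shows "x \<in> surds"
proof -
  have "(2 * a * x + b)\<^sup>2 = b\<^sup>2 - 4 * a * c"
    using assms(5) by algebra
  then have "\<bar>2 * a * x + b\<bar> = sqrt (b\<^sup>2 - 4 * a * c)"
    by (metis real_sqrt_abs)
  also have "\<dots> \<in> surds" using assms by simp
  finally have "2 * a * x + b \<in> surds" by simp
  then have "(2 * a * x + b - b) / (2 * a) \<in> surds"
    using assms by (intro surds_divide surds_diff surds_mult surds_numeral)
  then show ?thesis using \<open>a \<noteq> 0\<close> by simp
qed

text \<open>The line equation eliminates one coordinate, and the circle equation becomes a quadratic
  in the other.\<close>

lemma line_circle_intersection_surds: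
  assumes "a \<in> surds" "b \<in> surds" "c \<in> surds" "p \<in> surds" "q \<in> surds" "r \<in> surds"
    and "a \<noteq> 0 \<or> b \<noteq> 0" "a * x + b * y + c = 0" "x\<^sup>2 + y\<^sup>2 + p * x + q * y + r = 0"
  shows "x \<in> surds \<and> y \<in> surds"
proof -
  \<comment> \<open>The case \<open>a \<noteq> 0\<close>, with coefficients generalized so that
    exchanging the two coordinates covers \<open>b \<noteq> 0\<close>.\<close>
  have main: "x \<in> surds \<and> y \<in> surds"
    if "a \<in> surds" "b \<in> surds" "p \<in> surds" "q \<in> surds" "a \<noteq> 0"
      and e: "a * x + b * y + c = 0" "x\<^sup>2 + y\<^sup>2 + p * x + q * y + r = 0"
    for a b p q x y :: real
  proof
    note F = that(1-4) assms(3,6)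
    \<comment> \<open>The circle equation times \<open>a\<^sup>2\<close>, with \<open>a * x\<close>
      replaced by \<open>- (b * y + c)\<close>.\<close>
    have eq: "(a\<^sup>2 + b\<^sup>2) * y\<^sup>2 + (2 * b * c - a * p * b + a\<^sup>2 * q) * y + (c\<^sup>2 - a * p * c + a\<^sup>2 * r) = 0"
      using e by algebra
    have nz: "a\<^sup>2 + b\<^sup>2 \<noteq> 0" using \<open>a \<noteq> 0\<close> by simp
    show y: "y \<in> surds"
      by (rule surds_quadratic_root[OF _ _ _ nz eq]) (simp_all add: F)
    have "x * a = - (b * y + c)" using e(1) by (simp add: algebra_simps)
    then have "x = - (b * y + c) / a" using \<open>a \<noteq> 0\<close> by (metis nonzero_mult_div_cancel_right)
    also have "\<dots> \<in> surds"
      by (intro surds_divide surds_uminus_iff[THEN iffD2] surds_add surds_mult F y)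
    finally show "x \<in> surds" .
  qed
  show ?thesis
  proof (cases "a = 0")
    case False
    with main[of a b p q x y] assms show ?thesis by blast
  next
    case True
    then have "b \<noteq> 0" using assms(7) by simp
    moreover have "b * y + a * x + c = 0" "y\<^sup>2 + x\<^sup>2 + q * y + p * x + r = 0"
      using assms(8,9) by linarith+
    ultimately show ?thesis using main[of b a q p y x] assms(1-6) by blast
  qed
qed

section \<open>The translated surd plane, its lines and its circles\<close>

text \<open>Coordinates are taken relative to \<open>t\<close>, whose own coordinates may fail to be
  surds.\<close>

definition surd_points :: "point \<Rightarrow> point set" where
  "surd_points t = {x. (x - t) $ 1 \<in> surds \<and> (x - t) $ 2 \<in> surds}"

definition surd_lines :: "point \<Rightarrow> point set set" where
  "surd_lines t = {{x. a * (x - t) $ 1 + b * (x - t) $ 2 + c = 0} | a b c.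
     a \<in> surds \<and> b \<in> surds \<and> c \<in> surds \<and> (a \<noteq> 0 \<or> b \<noteq> 0)}"

text \<open>The leading coefficients are 1, so subtracting two such equations leaves a linear one.
  Single points and the empty set also occur.\<close>

definition surd_circles :: "point \<Rightarrow> point set set" where
  "surd_circles t =
     {{x. ((x - t) $ 1)\<^sup>2 + ((x - t) $ 2)\<^sup>2 + p * (x - t) $ 1 + q * (x - t) $ 2 + r = 0} | p q r.
        p \<in> surds \<and> q \<in> surds \<and> r \<in> surds}"

text \<open>Rational offsets from \<open>t\<close> already come arbitrarily close to any
  centre.\<close>

lemma surd_points_dense:
  assumes "\<rho> > 0"
  shows "\<exists>x\<in>surd_points t. x \<in> ball c \<rho>"
proof -
  \<comment> \<open>Half the radius per coordinate keeps the sum of the two errors, which bounds the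
    norm, below \<open>\<rho>\<close>.\<close>
  obtain q1 :: real where q1: "q1 \<in> \<rat>" "(c - t) $ 1 < q1" "q1 < (c - t) $ 1 + \<rho> / 2"
    using Rats_dense_in_real[of "(c - t) $ 1" "(c - t) $ 1 + \<rho> / 2"] assms by auto
  obtain q2 :: real where q2: "q2 \<in> \<rat>" "(c - t) $ 2 < q2" "q2 < (c - t) $ 2 + \<rho> / 2"
    using Rats_dense_in_real[of "(c - t) $ 2" "(c - t) $ 2 + \<rho> / 2"] assms by auto
  define x where "x = t + vector [q1, q2]"
  have "x \<in> surd_points t"
    using q1(1) q2(1) Rats_subset_surds by (auto simp: surd_points_def x_def)
  moreover have "norm (x - c) \<le> \<bar>(x - c) $ 1\<bar> + \<bar>(x - c) $ 2\<bar>"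
    using norm_le_l1_cart[of "x - c"] by (simp add: sum_2)
  then have "norm (x - c) < \<rho>"
    using q1 q2 by (simp add: x_def)
  ultimately show ?thesis by (auto simp: dist_norm norm_minus_commute)
qed

section \<open>Drawing lines and circles from points of the translate\<close>

text \<open>The line is where the determinant of \<open>x - a\<close> and the direction
  \<open>b - a\<close> vanishes.\<close>

lemma line_through_surd_points:
  assumes "a \<in> surd_points t" "b \<in> surd_points t" "a \<noteq> b"
  shows "line_through a b \<in> surd_lines t"
proof -
  define u1 u2 where "u1 = (b - a) $ 1" and "u2 = (b - a) $ 2"
  \<comment> \<open>The constant that makes \<open>a\<close> satisfy the line equation.\<close>
  define c where "c = u1 * (a - t) $ 2 - u2 * (a - t) $ 1"
  have u: "u1 = (b - t) $ 1 - (a - t) $ 1" "u2 = (b - t) $ 2 - (a - t) $ 2"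
    by (simp_all add: u1_def u2_def)
  have F: "u1 \<in> surds" "u2 \<in> surds"
    using assms unfolding u surd_points_def mem_Collect_eq by (blast intro: surds_diff)+
  then have "c \<in> surds"
    using assms unfolding c_def surd_points_def mem_Collect_eq
    by (blast intro: surds_diff surds_mult)
  have nz: "u1 \<noteq> 0 \<or> u2 \<noteq> 0"
    using assms(3) by (auto simp: u1_def u2_def vec_eq_iff forall_2)
  have "x \<in> line_through a b \<longleftrightarrow> u2 * (x - t) $ 1 + (- u1) * (x - t) $ 2 + c = 0" for x
  proof -
    have "x \<in> line_through a b \<longleftrightarrow> (\<exists>s. x = a + s *\<^sub>R (b - a))"
      unfolding line_through_def affine_hull_2_alt by auto
    also have "\<dots> \<longleftrightarrow> (\<exists>s. x $ 1 - a $ 1 = s * u1 \<and> x $ 2 - a $ 2 = s * u2)"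
      by (simp add: vec_eq_iff forall_2 u1_def u2_def algebra_simps)
    also have "\<dots> \<longleftrightarrow> u2 * (x $ 1 - a $ 1) = u1 * (x $ 2 - a $ 2)" (is "?L \<longleftrightarrow> ?R")
    proof
      assume ?R
      show ?L
      \<comment> \<open>The parameter is recovered from a nonzero component of the
        direction.\<close>
      proof (cases "u1 = 0")
        case True
        with nz \<open>?R\<close> show ?thesis by (intro exI[of _ "(x $ 2 - a $ 2) / u2"]) auto
      next
        case False
        with \<open>?R\<close> show ?thesis
          by (intro exI[of _ "(x $ 1 - a $ 1) / u1"]) (auto simp: field_simps)
      qed
    qed auto
    also have "\<dots> \<longleftrightarrow> u2 * (x - t) $ 1 + (- u1) * (x - t) $ 2 + c = 0"
      by (simp add: c_def algebra_simps)
    finally show ?thesis .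
  qed
  then have "line_through a b = {x. u2 * (x - t) $ 1 + (- u1) * (x - t) $ 2 + c = 0}"
    by blast
  moreover have "- u1 \<in> surds" "u2 \<noteq> 0 \<or> - u1 \<noteq> 0" using F nz by auto
  ultimately show ?thesis
    using F(2) \<open>c \<in> surds\<close> unfolding surd_lines_def by blast
qed

lemma dist_power2_2:
  fixes x y :: point
  shows "(dist x y)\<^sup>2 = (x $ 1 - y $ 1)\<^sup>2 + (x $ 2 - y $ 2)\<^sup>2"
  by (simp add: dist_vec_def L2_set_def sum_2 dist_real_def)

text \<open>Expanding the squared distance equation about \<open>t\<close> gives surd coefficients;
  the radius enters only through its square.\<close>

lemma compass_surd_points:
  assumes "a \<in> surd_points t" "b \<in> surd_points t" "c \<in> surd_points t"
  shows "sphere a (dist b c) \<in> surd_circles t"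
proof -
  define p where "p = - 2 * (a - t) $ 1"
  define q where "q = - 2 * (a - t) $ 2"
  define r where "r = ((a - t) $ 1)\<^sup>2 + ((a - t) $ 2)\<^sup>2
    - (((b - t) $ 1 - (c - t) $ 1)\<^sup>2 + ((b - t) $ 2 - (c - t) $ 2)\<^sup>2)"
  have "p \<in> surds" "q \<in> surds" "r \<in> surds"
    using assms unfolding p_def q_def r_def surd_points_def mem_Collect_eq
    by (blast intro: surds_diff surds_mult surds_add surds_power surds_numeral
        surds_uminus_iff[THEN iffD2])+
  moreover have "sphere a (dist b c) =
    {x. ((x - t) $ 1)\<^sup>2 + ((x - t) $ 2)\<^sup>2 + p * (x - t) $ 1 + q * (x - t) $ 2 + r = 0}"
  proof -
    have "sphere a (dist b c) = {x. (dist a x)\<^sup>2 = (dist b c)\<^sup>2}"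
      by auto
    then show ?thesis
      unfolding dist_power2_2
      by (auto simp: p_def q_def r_def power2_eq_square algebra_simps)
  qed
  ultimately show ?thesis unfolding surd_circles_def by blast
qed

section \<open>Intersecting lines and circles\<close>

text \<open>Cramer's rule with determinant \<open>d\<close>: two lines with a common point are
  either equal or not parallel.\<close>

lemma surd_lines_intersection:
  assumes "X \<in> surd_lines t" "Y \<in> surd_lines t" "X \<noteq> Y" "x \<in> X" "x \<in> Y"
  shows "x \<in> surd_points t"
proof -
  obtain a b c where X: "X = {x. a * (x - t) $ 1 + b * (x - t) $ 2 + c = 0}"
    and F: "a \<in> surds" "b \<in> surds" "c \<in> surds" and ab: "a \<noteq> 0 \<or> b \<noteq> 0"
    using assms(1) unfolding surd_lines_def by blast
  obtain a' b' c' where Y: "Y = {x. a' * (x - t) $ 1 + b' * (x - t) $ 2 + c' = 0}"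
    and F': "a' \<in> surds" "b' \<in> surds" "c' \<in> surds" and ab': "a' \<noteq> 0 \<or> b' \<noteq> 0"
    using assms(2) unfolding surd_lines_def by blast
  define x1 x2 where x12: "x1 = (x - t) $ 1" "x2 = (x - t) $ 2"
  have e: "a * x1 + b * x2 + c = 0" "a' * x1 + b' * x2 + c' = 0"
    using assms(4,5) unfolding X Y x12 by auto
  define d where "d = a * b' - a' * b"
  have "d \<noteq> 0"
  proof
    assume d: "d = 0"
    have "a * y1 + b * y2 + c = 0 \<longleftrightarrow> a' * y1 + b' * y2 + c' = 0" for y1 y2
    proof -
      \<comment> \<open>With \<open>d = 0\<close> and a common point the equations are proportional;
        a nonzero coefficient then carries zeros of one to the other.\<close>
      have *: "a' * (a * y1 + b * y2 + c) = a * (a' * y1 + b' * y2 + c')"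
              "b' * (a * y1 + b * y2 + c) = b * (a' * y1 + b' * y2 + c')"
        using e d unfolding d_def by algebra+
      with ab ab' show ?thesis by (metis mult_eq_0_iff)
    qed
    then have "X = Y" unfolding X Y by blast
    with assms(3) show False ..
  qed
  have "x1 * d = b * c' - b' * c" "x2 * d = a' * c - a * c'"
    using e unfolding d_def by algebra+
  then have "x1 = (b * c' - b' * c) / d" "x2 = (a' * c - a * c') / d"
    using \<open>d \<noteq> 0\<close> by (simp_all add: field_simps)
  moreover have "d \<in> surds" using F F' by (simp add: d_def)
  ultimately have "x1 \<in> surds" "x2 \<in> surds" using F F' by simp_all
  then show ?thesis by (simp add: surd_points_def x12)
qed

lemma surd_line_circle_intersection:
  assumes "X \<in> surd_lines t" "Y \<in> surd_circles t" "x \<in> X" "x \<in> Y"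
  shows "x \<in> surd_points t"
proof -
  obtain a b c where l: "a * (x - t) $ 1 + b * (x - t) $ 2 + c = 0"
    and F: "a \<in> surds" "b \<in> surds" "c \<in> surds" and ab: "a \<noteq> 0 \<or> b \<noteq> 0"
    using assms(1,3) unfolding surd_lines_def by blast
  obtain p q r where k: "((x - t) $ 1)\<^sup>2 + ((x - t) $ 2)\<^sup>2 + p * (x - t) $ 1 + q * (x - t) $ 2 + r = 0"
    and F': "p \<in> surds" "q \<in> surds" "r \<in> surds"
    using assms(2,4) unfolding surd_circles_def by blast
  show ?thesis
    using line_circle_intersection_surds[OF F F' ab l k] by (simp add: surd_points_def)
qed

text \<open>The points common to two circles lie on their radical axis.\<close>

lemma surd_circles_intersection:
  assumes "X \<in> surd_circles t" "Y \<in> surd_circles t" "X \<noteq> Y" "x \<in> X" "x \<in> Y"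
  shows "x \<in> surd_points t"
proof -
  obtain p q r where
    X: "X = {x. ((x - t) $ 1)\<^sup>2 + ((x - t) $ 2)\<^sup>2 + p * (x - t) $ 1 + q * (x - t) $ 2 + r = 0}"
    and F: "p \<in> surds" "q \<in> surds" "r \<in> surds"
    using assms(1) unfolding surd_circles_def by blast
  obtain p' q' r' where
    Y: "Y = {x. ((x - t) $ 1)\<^sup>2 + ((x - t) $ 2)\<^sup>2 + p' * (x - t) $ 1 + q' * (x - t) $ 2 + r' = 0}"
    and F': "p' \<in> surds" "q' \<in> surds" "r' \<in> surds"
    using assms(2) unfolding surd_circles_def by blast
  let ?Z = "{x. (p - p') * (x - t) $ 1 + (q - q') * (x - t) $ 2 + (r - r') = 0}"
  have axis: "(p - p') * (x - t) $ 1 + (q - q') * (x - t) $ 2 + (r - r') = 0"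
    using assms(4,5) unfolding X Y mem_Collect_eq by algebra
  \<comment> \<open>Otherwise the axis equation at the common point forces equal constants, and the
    circles coincide.\<close>
  have "p - p' \<noteq> 0 \<or> q - q' \<noteq> 0"
  proof (rule ccontr)
    assume "\<not> ?thesis"
    then have "p = p'" "q = q'" "r = r'" using axis by simp_all
    with assms(3) X Y show False by simp
  qed
  then have "?Z \<in> surd_lines t"
    unfolding surd_lines_def using F F' surds_diff by blast
  from surd_line_circle_intersection[OF this assms(1) _ assms(4)] axis show ?thesis by simp
qed

section \<open>Surd letters under one construction step\<close>

text \<open>Discs are unconstrained: only lines and circles can be intersected.\<close>

definition surd_letters :: "point \<Rightarrow> letter set" where
  "surd_letters t =
     Pt ` surd_points t \<union> {Fig X | X. X \<in> lines \<union> circles \<longrightarrow> X \<in> surd_lines t \<union> surd_circles t}"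

lemma Pt_in_surd_letters [simp]: "Pt x \<in> surd_letters t \<longleftrightarrow> x \<in> surd_points t"
  by (auto simp: surd_letters_def)

lemma Fig_in_surd_letters [simp]:
  "Fig X \<in> surd_letters t \<longleftrightarrow> (X \<in> lines \<union> circles \<longrightarrow> X \<in> surd_lines t \<union> surd_circles t)"
  by (auto simp: surd_letters_def)

text \<open>A deterministic rule leaves at most one child, and closure keeps its new letter in
  \<open>surd_letters t\<close>. Only at a disc is there a choice, and density supplies a suitable
  point.\<close>

lemma ec_rule_surd_child:
  assumes rule: "ec_rule open_discs u C" and u: "set u \<subseteq> surd_letters t" and "C \<noteq> {}"
  shows "\<exists>v\<in>C. set v \<subseteq> surd_letters t"
proof -
  have nth: "u ! i \<in> surd_letters t" if "i < length u" for i
    using u that nth_mem by blast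
  show ?thesis
    using rule
  proof cases
    case leaf
    with \<open>C \<noteq> {}\<close> show ?thesis by simp
  next
    case (line i j a b)
    then have "a \<in> surd_points t" "b \<in> surd_points t"
      using nth[of i] nth[of j] by auto
    with line u line_through_surd_points show ?thesis by simp
  next
    case (circle i j k a b c)
    then have "a \<in> surd_points t" "b \<in> surd_points t" "c \<in> surd_points t"
      using nth[of i] nth[of j] nth[of k] by auto
    \<comment> \<open>For \<open>b = c\<close> the new letter is the point \<open>a\<close> itself,
      already in the translate.\<close>
    with circle u compass_surd_points show ?thesis by (simp add: compass_def)
  next
    case (intersection i j X Y p)
    then have "X \<in> surd_lines t \<union> surd_circles t" "Y \<in> surd_lines t \<union> surd_circles t"
      using nth[of i] nth[of j] by auto
    moreover have "X \<noteq> Y" "p \<in> X" "p \<in> Y"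
      using intersection by auto
    ultimately have "p \<in> surd_points t"
      by (metis UnE surd_lines_intersection surd_line_circle_intersection
          surd_circles_intersection)
    with intersection u show ?thesis by simp
  next
    case (region D)
    \<comment> \<open>A disc is neither a line nor a circle, so the condition on \<open>Fig\<close>
      letters holds vacuously.\<close>
    then have "D \<notin> lines \<union> circles"
      using admissible_open_discs unfolding admissible_def by blast
    with region u show ?thesis by simp
  next
    case (arbitrary_point D)
    then obtain c \<rho> where "D = ball c \<rho>" "\<rho> > 0" by (auto simp: open_discs_def)
    then obtain x where "x \<in> surd_points t" "x \<in> D" using surd_points_dense by blast
    then have "u @ [Pt x] \<in> C" "set (u @ [Pt x]) \<subseteq> surd_letters t"
      using arbitrary_point(1) u by auto
    then show ?thesis ..
  qed
qed

section \<open>Branches along an invariant\<close>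

text \<open>Repeatedly choosing a child with \<open>P\<close> traces a walk from the root that stops
  at a leaf or never stops, hence a branch.\<close>

lemma rooted_tree_branch_in:
  assumes T: "rooted_tree r V E" and "P r"
    and child: "\<And>u. u \<in> V \<Longrightarrow> P u \<Longrightarrow> children E u \<noteq> {} \<Longrightarrow> \<exists>v\<in>children E u. P v"
  shows "\<exists>B. branch V E B \<and> (\<forall>u\<in>walk_verts B. P u)"
proof -
  have "\<exists>v. u \<in> V \<longrightarrow> P u \<longrightarrow> children E u \<noteq> {} \<longrightarrow> v \<in> children E u \<and> P v" for u
    using child[of u] by blast
  then obtain next_vert where next_vert: "next_vert u \<in> children E u \<and> P (next_vert u)"
    if "u \<in> V" "P u" "children E u \<noteq> {}" for u
    by metis
  define f where "f n = (next_vert ^^ n) r" for n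
  have step: "(u, next_vert u) \<in> E \<and> next_vert u \<in> V \<and> P (next_vert u)"
    if "u \<in> V" "P u" "children E u \<noteq> {}" for u
    using next_vert[OF that] T by (auto simp: children_def rooted_tree_def)
  have f: "f 0 = r" "f (Suc n) = next_vert (f n)" for n
    by (simp_all add: f_def)
  have r: "r \<in> V" using T by (simp add: rooted_tree_def)
  show ?thesis
  proof (cases "\<exists>n. children E (f n) = {}")
    case False
    have fn: "f n \<in> V \<and> P (f n)" for n
      by (induction n) (use r \<open>P r\<close> step False f in auto)
    then have "branch V E (Infinite f)"
      using step False f unfolding branch_Infinite_iff[OF T] by auto
    with fn show ?thesis by (intro exI[of _ "Infinite f"]) auto
  next
    case True
    \<comment> \<open>\<open>f\<close> is controlled only up to the first leaf, so the walk is cut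
      there; \<open>Suc n\<close> counts the vertices from \<open>f 0\<close> to
      \<open>f n\<close>.\<close>
    define n where "n = (LEAST n. children E (f n) = {})"
    have leaf: "children E (f n) = {}" unfolding n_def using True by (rule LeastI_ex)
    have nonleaf: "children E (f k) \<noteq> {}" if "k < n" for k
      using not_less_Least that unfolding n_def by blast
    have fk: "f k \<in> V \<and> P (f k)" if "k \<le> n" for k
      using that by (induction k) (use r \<open>P r\<close> step nonleaf f in auto)
    let ?xs = "map f [0..<Suc n]"
    have "successively (\<lambda>u v. (u, v) \<in> E) ?xs"
      unfolding successively_conv_nth using step fk nonleaf f by (auto simp del: upt_Suc)
    then have "branch V E (Finite ?xs)"
      using fk leaf f unfolding branch_Finite_iff[OF T]
      by (auto simp: is_leaf_def hd_map simp del: upt_Suc) (auto simp: hd_append)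
    moreover have "\<forall>u\<in>walk_verts (Finite ?xs). P u" using fk by auto
    ultimately show ?thesis by blast
  qed
qed

section \<open>A translate of the surd plane that misses the origin\<close>

theorem theorem2p13:
  shows "(\<forall>V E. EC open_discs [] V E \<longrightarrow>
            (\<exists>B. branch V E B \<and> (\<forall>u\<in>walk_verts B. Pt 0 \<notin> set u)))
         \<and> \<not> constructs open_discs {[Pt 0]} []"
proof -
  obtain s :: real where "s \<notin> surds"
    using countable_surds uncountable_UNIV_real by (metis UNIV_eq_I)
  \<comment> \<open>Both coordinates of \<open>0 - vec s\<close> are \<open>- s\<close>, which is
    not a surd.\<close>
  then have "0 \<notin> surd_points (vec s)" by (simp add: surd_points_def)
  then have 0: "Pt 0 \<notin> surd_letters (vec s)" by simp
  have avoid: "\<exists>B. branch V E B \<and> (\<forall>u\<in>walk_verts B. Pt 0 \<notin> set u)"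
    if "EC open_discs [] V E" for V E
  proof -
    have "\<exists>B. branch V E B \<and> (\<forall>u\<in>walk_verts B. set u \<subseteq> surd_letters (vec s))"
      using that by (intro rooted_tree_branch_in ec_rule_surd_child) (auto simp: EC_def)
    with 0 show ?thesis by blast
  qed
  moreover have "\<not> constructs open_discs {[Pt 0]} []"
  proof
    assume "constructs open_discs {[Pt 0]} []"
    then obtain V E where EC: "EC open_discs [] V E" and "terminating V E"
      and leaf: "\<And>u. is_leaf V E u \<Longrightarrow> \<exists>j<length u. drop j u = [Pt 0]"
      unfolding constructs_def by blast
    \<comment> \<open>Termination makes the avoiding branch finite, so it ends in a leaf, which
      would have to contain the origin.\<close>
    with avoid obtain xs where b: "branch V E (Finite xs)" "\<forall>u\<in>set xs. Pt 0 \<notin> set u"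
      unfolding terminating_def by (metis walk_verts.simps(1))
    have T: "rooted_tree [] V E" using EC by (simp add: EC_def)
    from b(1) have "last xs \<in> set xs" "is_leaf V E (last xs)"
      unfolding branch_Finite_iff[OF T] by auto
    then obtain j where "drop j (last xs) = [Pt 0]" using leaf by blast
    then have "Pt 0 \<in> set (last xs)" by (metis in_set_dropD list.set_intros(1))
    with b(2) \<open>last xs \<in> set xs\<close> show False by blast
  qed
  ultimately show ?thesis by blast
qed

end
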